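(* Let $x\in\mathcal{C}^2([0,t_f])$ be a real-valued function, and let $x_M(t)$ be the composite Bernstein approximant of $x(t)$ with $K$ segments of order $N$ and time knots $0=t_0<t_1<\dots<t_K=t_f$ satisfying $|t_k-t_{k-1}|\le\frac{C_t}{K}$ for all $k=1,\dots,K$, where $C_t>0$ is independent of $K$. Then $$\left\Vert\int_0^{t_f}x_M(t)\,dt-\int_0^{t_f}x(t)\,dt\right\Vert\le\frac{C}{K^2N},$$ where $$C=\frac{C_t^3}{8}\max_{\tau\in[t_{k-1},t_k],\ k=1,\dots,K}|\ddot{x}(\tau)|.$$
   Context: $K,N\ge1$ are integers. For $k=1,\dots,K$ and $j=0,\dots,N$, the Bernstein basis on $I_k=[t_{k-1},t_k]$ is $$b_{j,N}^{[k]}(t)=\binom{N}{j}\frac{(t-t_{k-1})^j(t_k-t)^{N-j}}{(t_k-t_{k-1})^N}.$$ With $t_{k,j}=t_{k-1}+\frac{j}{N}(t_k-t_{k-1})$, the composite Bernstein approximant of $x$ is the function $x_M:[0,t_f]\to\mathbb{R}$ given by $$x_M(t)=\sum_{j=0}^N x(t_{k,j})\,b_{j,N}^{[k]}(t),\qquad t\in I_k,\ k=1,\dots,K.$$ (The index $M$ is $M+1=K(N+1)$, the total number of coefficients.) *)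

theory Defs
  imports "HOL-Analysis.Analysis"
begin

definition bern_basis :: "(nat \<Rightarrow> real) \<Rightarrow> nat \<Rightarrow> nat \<Rightarrow> nat \<Rightarrow> real \<Rightarrow> real" where
  "bern_basis t N k j s =
     real (N choose j) * ((s - t (k - 1)) ^ j * (t k - s) ^ (N - j)) / (t k - t (k - 1)) ^ N"

definition bern_node :: "(nat \<Rightarrow> real) \<Rightarrow> nat \<Rightarrow> nat \<Rightarrow> nat \<Rightarrow> real" where
  "bern_node t N k j = t (k - 1) + real j / real N * (t k - t (k - 1))"

definition bern_segment ::
    "(real \<Rightarrow> real) \<Rightarrow> (nat \<Rightarrow> real) \<Rightarrow> nat \<Rightarrow> nat \<Rightarrow> real \<Rightarrow> real" where
  "bern_segment x t N k s = (\<Sum>j=0..N. x (bern_node t N k j) * bern_basis t N k j s)"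

text \<open>At an interior knot two segments apply; the first one is used. The choice is immaterial by
  \<open>composite_bernstein_eq\<close> below. Values outside \<open>{t 0..t K}\<close> are unspecified.\<close>

definition composite_bernstein ::
    "(real \<Rightarrow> real) \<Rightarrow> (nat \<Rightarrow> real) \<Rightarrow> nat \<Rightarrow> nat \<Rightarrow> real \<Rightarrow> real" where
  "composite_bernstein x t K N s =
     bern_segment x t N (LEAST k. k \<in> {1..K} \<and> s \<in> {t (k - 1)..t k}) s"

lemma bern_segment_left:
  assumes "N \<ge> 1" "t (k - 1) < t k"
  shows "bern_segment x t N k (t (k - 1)) = x (t (k - 1))"
proof -
  have "bern_segment x t N k (t (k - 1)) = (\<Sum>j=0..N. if j = 0 then x (t (k - 1)) else 0)"
    unfolding bern_segment_def
    by (rule sum.cong) (use assms in \<open>auto simp: bern_node_def bern_basis_def\<close>)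
  then show ?thesis by simp
qed

lemma bern_segment_right:
  assumes "N \<ge> 1" "t (k - 1) < t k"
  shows "bern_segment x t N k (t k) = x (t k)"
proof -
  have "bern_segment x t N k (t k) = (\<Sum>j=0..N. if j = N then x (t k) else 0)"
    unfolding bern_segment_def
    by (rule sum.cong) (use assms in \<open>auto simp: bern_node_def bern_basis_def\<close>)
  then show ?thesis by simp
qed

lemma composite_bernstein_eq:
  assumes "N \<ge> 1" and inc: "\<And>k. k \<in> {1..K} \<Longrightarrow> t (k - 1) < t k"
    and k: "k \<in> {1..K}" and s: "s \<in> {t (k - 1)..t k}"
  shows "composite_bernstein x t K N s = bern_segment x t N k s"
proof -
  define l where "l = (LEAST k. k \<in> {1..K} \<and> s \<in> {t (k - 1)..t k})"
  have l: "l \<in> {1..K}" "s \<in> {t (l - 1)..t l}"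
    using LeastI[of "\<lambda>k. k \<in> {1..K} \<and> s \<in> {t (k - 1)..t k}" k] k s unfolding l_def by blast+
  have "l \<le> k"
    unfolding l_def by (rule Least_le) (use k s in blast)
  have mono: "t i < t j" if "i < j" "j \<le> K" for i j
    using that
  proof (induction j)
    case (Suc j)
    then show ?case
      using inc[of "Suc j"] by (cases "i = j") auto
  qed simp
  have "bern_segment x t N l s = bern_segment x t N k s"
  proof (cases "l = k")
    case False
    with \<open>l \<le> k\<close> have "l \<le> k - 1" by simp
    moreover have "k - 1 \<le> K"
      using k by auto
    then have "\<not> l < k - 1"
      using mono[of l "k - 1"] k s l by fastforce
    ultimately have "l = k - 1" by simp
    with s l have "s = t l" by auto
    have "bern_segment x t N l s = x s"
      using bern_segment_right[of N t l] assms(1) inc l(1) \<open>s = t l\<close> by simp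
    moreover have "bern_segment x t N k s = x s"
      using bern_segment_left[of N t k] assms(1) inc k \<open>s = t l\<close> \<open>l = k - 1\<close> by simp
    ultimately show ?thesis by simp
  qed simp
  then show ?thesis
    unfolding composite_bernstein_def l_def .
qed

text \<open>The derivative relative to \<open>S\<close> is one-sided at the endpoints when \<open>S\<close> is a compact
  interval, and is unique if that interval is nondegenerate.\<close>

definition deriv_on :: "real set \<Rightarrow> (real \<Rightarrow> real) \<Rightarrow> real \<Rightarrow> real" where
  "deriv_on S f s = vector_derivative f (at s within S)"

definition C2_on :: "real set \<Rightarrow> (real \<Rightarrow> real) \<Rightarrow> bool" where
  "C2_on S f \<longleftrightarrow> f differentiable_on S \<and> deriv_on S f differentiable_on S \<and>
     continuous_on S (deriv_on S (deriv_on S f))"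

end

theory Submission
  imports Defs
begin

text \<open>On a segment of length \<open>h\<close>, write \<open>p = (s - t\<^sub>k\<^sub>-\<^sub>1) / h\<close>. The Bernstein weights at \<open>s\<close> are the
  binomial probabilities with parameters \<open>N\<close> and \<open>p\<close>, so the nodes have mean \<open>s\<close> and variance
  \<open>h\<^sup>2 p (1 - p) / N \<le> h\<^sup>2 / (4 N)\<close>. Averaging the Taylor expansion of \<open>x\<close> at \<open>s\<close> over these weights
  kills the linear term and leaves the uniform error bound \<open>max \<bar>x''\<bar> * h\<^sup>2 / (8 N)\<close>. Integrating it
  over \<open>[0, t\<^sub>f]\<close>, with \<open>h \<le> C\<^sub>t / K\<close> and hence \<open>t\<^sub>f \<le> C\<^sub>t\<close>, gives the claim.\<close>

text \<open>The mean value inequality makes \<open>f'\<close> vary by at most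
  \<open>M * \<bar>v - s\<bar>\<close> from \<open>s\<close>; a second mean value comparison,
  against a quadratic majorant, integrates this. Derivatives are taken within \<open>{a..b}\<close>,
  so \<open>s\<close> and \<open>u\<close> may be endpoints.\<close>

lemma vector_taylor_bound_2:
  fixes f f' f'' :: "real \<Rightarrow> real"
  assumes f: "\<And>v. v \<in> {a..b} \<Longrightarrow> (f has_vector_derivative f' v) (at v within {a..b})"
    and f': "\<And>v. v \<in> {a..b} \<Longrightarrow> (f' has_vector_derivative f'' v) (at v within {a..b})"
    and M: "\<And>v. v \<in> {a..b} \<Longrightarrow> \<bar>f'' v\<bar> \<le> M"
    and s: "s \<in> {a..b}" and u: "u \<in> {a..b}"
  shows "\<bar>f u - f s - f' s * (u - s)\<bar> \<le> M / 2 * (u - s)\<^sup>2"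
proof -
  have lip: "\<bar>f' v - f' s\<bar> \<le> M * \<bar>v - s\<bar>" if "v \<in> {a..b}" for v
  proof -
    have "norm (f' v - f' s) \<le> M * norm (v - s)"
      by (rule field_differentiable_bound[where S = "{a..b}" and f' = f''])
        (use f' M s that in \<open>auto simp: has_real_derivative_iff_has_vector_derivative\<close>)
    then show ?thesis by simp
  qed
  \<comment> \<open>With the linear part removed, the Taylor remainder is the increment
    \<open>g u - g s\<close>, and \<open>g\<close> has derivative
    \<open>f' v - f' s\<close>.\<close>
  define g where "g v = f v - f' s * v" for v
  have g: "(g has_vector_derivative (f' v - f' s)) (at v within {a..b})" if "v \<in> {a..b}" for v
    using f[OF that] unfolding g_def has_real_derivative_iff_has_vector_derivative[symmetric]
    by (auto intro!: derivative_eq_intros)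
  have cont: "continuous_on {a..b} g"
    using g by (rule continuous_on_vector_derivative)
  have g_at: "(g has_vector_derivative (f' v - f' s)) (at v)" if "v \<in> {a<..<b}" for v
    using g[of v] that at_within_Icc_at[of a v b] by auto
  consider "u = s" | "s < u" | "u < s" by linarith
  then have "\<bar>g u - g s\<bar> \<le> M / 2 * (u - s)\<^sup>2"
  proof cases
    case 2
    have "norm (g u - g s) \<le> M / 2 * (u - s)\<^sup>2 - M / 2 * (s - s)\<^sup>2"
    proof (rule differentiable_bound_general[where f' = "\<lambda>v. f' v - f' s" and \<phi>' = "\<lambda>v. M * (v - s)"
          and \<phi> = "\<lambda>v. M / 2 * (v - s)\<^sup>2"])
      show "continuous_on {s..u} g"
        using cont by (rule continuous_on_subset) (use s u in auto)
      show "((\<lambda>v. M / 2 * (v - s)\<^sup>2) has_vector_derivative M * (v - s)) (at v)" for v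
        unfolding has_real_derivative_iff_has_vector_derivative[symmetric]
        by (auto intro!: derivative_eq_intros)
      show "norm (f' v - f' s) \<le> M * (v - s)" if "s < v" "v < u" for v
        using lip[of v] that s u by auto
    qed (use 2 g_at s u in \<open>auto intro!: continuous_intros\<close>)
    then show ?thesis by simp
  next
    case 3
    \<comment> \<open>Left of \<open>s\<close> the majorant changes sign: its derivative
      \<open>M * (s - v)\<close> then equals the Lipschitz bound
      \<open>M * \<bar>v - s\<bar>\<close>.\<close>
    have "norm (g s - g u) \<le> - (M / 2 * (s - s)\<^sup>2) - - (M / 2 * (u - s)\<^sup>2)"
    proof (rule differentiable_bound_general[where f' = "\<lambda>v. f' v - f' s" and \<phi>' = "\<lambda>v. M * (s - v)"
          and \<phi> = "\<lambda>v. - (M / 2 * (v - s)\<^sup>2)"])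
      show "continuous_on {u..s} g"
        using cont by (rule continuous_on_subset) (use s u in auto)
      show "((\<lambda>v. - (M / 2 * (v - s)\<^sup>2)) has_vector_derivative M * (s - v)) (at v)" for v
        unfolding has_real_derivative_iff_has_vector_derivative[symmetric]
        by (auto intro!: derivative_eq_intros simp: field_simps)
      show "norm (f' v - f' s) \<le> M * (s - v)" if "u < v" "v < s" for v
        using lip[of v] that s u by auto
    qed (use 3 g_at s u in \<open>auto intro!: continuous_intros\<close>)
    then show ?thesis by (simp add: abs_minus_commute)
  qed simp
  then show ?thesis by (simp add: g_def algebra_simps)
qed

text \<open>Rescaling the segment to the unit interval gives access to the moment identities for
  \<open>Bernstein\<close>.\<close>

lemma bern_basis_eq_Bernstein:
  assumes "t (k - 1) < t k" "j \<le> N"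
  shows "bern_basis t N k j s = Bernstein N j ((s - t (k - 1)) / (t k - t (k - 1)))"
proof -
  let ?h = "t k - t (k - 1)"
  have "1 - (s - t (k - 1)) / ?h = (t k - s) / ?h"
    using assms by (simp add: field_simps)
  moreover have "?h ^ N = ?h ^ j * ?h ^ (N - j)"
    using assms by (simp flip: power_add)
  ultimately show ?thesis
    by (simp add: bern_basis_def Bernstein_def power_divide)
qed

text \<open>The square is split as
  \<open>j * (j - 1) + (1 - 2 * N * p) * j + (N * p)\<^sup>2\<close>, since the second moment is
  known in its factorial form \<open>sum_kk_Bernstein\<close>.\<close>

lemma Bernstein_variance:
  fixes p :: real
  shows "(\<Sum>j\<le>N. (real j - real N * p)\<^sup>2 * Bernstein N j p) = real N * p * (1 - p)"
proof -
  have "(\<Sum>j\<le>N. (real j - real N * p)\<^sup>2 * Bernstein N j p)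
      = (\<Sum>j\<le>N. real j * (real j - 1) * Bernstein N j p)
        + (1 - 2 * real N * p) * (\<Sum>j\<le>N. real j * Bernstein N j p)
        + (real N * p)\<^sup>2 * (\<Sum>j\<le>N. Bernstein N j p)"
    unfolding sum_distrib_left sum.distrib[symmetric]
    by (rule sum.cong) (auto simp: algebra_simps power2_eq_square)
  also have "\<dots> = real N * p * (1 - p)"
    unfolding sum_kk_Bernstein sum_k_Bernstein sum_Bernstein
    by (simp add: algebra_simps power2_eq_square)
  finally show ?thesis .
qed

lemma bern_segment_error:
  fixes x x' x'' :: "real \<Rightarrow> real"
  assumes N: "N \<ge> 1" and lt: "t (k - 1) < t k" and sub: "{t (k - 1)..t k} \<subseteq> {a..b}"
    and x: "\<And>v. v \<in> {a..b} \<Longrightarrow> (x has_vector_derivative x' v) (at v within {a..b})"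
    and x': "\<And>v. v \<in> {a..b} \<Longrightarrow> (x' has_vector_derivative x'' v) (at v within {a..b})"
    and M: "\<And>v. v \<in> {a..b} \<Longrightarrow> \<bar>x'' v\<bar> \<le> M"
    and s: "s \<in> {t (k - 1)..t k}"
  shows "\<bar>bern_segment x t N k s - x s\<bar> \<le> M * (t k - t (k - 1))\<^sup>2 / (8 * real N)"
proof -
  define h p where "h = t k - t (k - 1)" and "p = (s - t (k - 1)) / h"
  define B where "B j = Bernstein N j p" for j
  \<comment> \<open>The first-order Taylor remainder of \<open>x\<close> at \<open>s\<close>,
    evaluated at the \<open>j\<close>-th node.\<close>
  define r where "r j = x (bern_node t N k j) - x s - x' s * (bern_node t N k j - s)" for j
  have h: "h > 0" using lt by (simp add: h_def)
  have p: "0 \<le> p" "p \<le> 1" using s h by (auto simp: p_def h_def)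
  have B: "B j \<ge> 0" for j
    using p by (auto simp: B_def intro: Bernstein_nonneg)
  have s_eq: "s = t (k - 1) + p * h" using h by (simp add: p_def)
  have node: "bern_node t N k j - s = h / real N * (real j - real N * p)" for j
    using N by (simp add: bern_node_def s_eq h_def field_simps)
  have node_in: "bern_node t N k j \<in> {a..b}" if "j \<le> N" for j
  proof -
    have "0 \<le> real j / real N * h" "real j / real N * h \<le> 1 * h"
      using that N h by (simp, intro mult_right_mono) auto
    then have "bern_node t N k j \<in> {t (k - 1)..t k}"
      by (simp add: bern_node_def h_def)
    then show ?thesis using sub by blast
  qed
  have M0: "M \<ge> 0" using M[of s] s sub by (meson abs_ge_zero order_trans subsetD)
  have "bern_segment x t N k s = (\<Sum>j\<le>N. x (bern_node t N k j) * B j)"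
    unfolding bern_segment_def atMost_atLeast0 B_def p_def h_def
    by (intro sum.cong refl) (simp add: bern_basis_eq_Bernstein[OF lt])
  \<comment> \<open>The factor of \<open>x' s\<close> is the weighted mean of the node offsets; it
    vanishes because the index \<open>j\<close> has mean \<open>N * p\<close>.\<close>
  also have "\<dots> = (\<Sum>j\<le>N. r j * B j) + x s * (\<Sum>j\<le>N. B j)
      + x' s * h / real N * ((\<Sum>j\<le>N. real j * B j) - real N * p * (\<Sum>j\<le>N. B j))"
    unfolding sum_distrib_left sum_subtractf[symmetric] sum.distrib[symmetric] r_def node
    by (rule sum.cong) (auto simp: algebra_simps)
  also have "\<dots> = (\<Sum>j\<le>N. r j * B j) + x s"
    unfolding B_def sum_k_Bernstein sum_Bernstein by simp
  finally have "\<bar>bern_segment x t N k s - x s\<bar> = \<bar>\<Sum>j\<le>N. r j * B j\<bar>" by simp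
  also have "\<dots> \<le> (\<Sum>j\<le>N. \<bar>r j * B j\<bar>)" by (rule sum_abs)
  also have "\<dots> \<le> (\<Sum>j\<le>N. M / 2 * (bern_node t N k j - s)\<^sup>2 * B j)"
  proof (rule sum_mono)
    fix j assume "j \<in> {..N}"
    then have "\<bar>r j\<bar> \<le> M / 2 * (bern_node t N k j - s)\<^sup>2"
      unfolding r_def using node_in s sub
      by (intro vector_taylor_bound_2[OF x x' M]) auto
    then show "\<bar>r j * B j\<bar> \<le> M / 2 * (bern_node t N k j - s)\<^sup>2 * B j"
      using mult_right_mono[OF _ B] B[of j] by (simp only: abs_mult abs_of_nonneg)
  qed
  also have "\<dots> = M / 2 * (h / real N)\<^sup>2 * (\<Sum>j\<le>N. (real j - real N * p)\<^sup>2 * B j)"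
    unfolding sum_distrib_left node power_mult_distrib by (simp only: mult_ac)
  also have "\<dots> = M * h\<^sup>2 / (2 * real N) * (p * (1 - p))"
    unfolding B_def Bernstein_variance using N by (simp add: field_simps power2_eq_square)
  \<comment> \<open>The value 1/4 is the maximum of \<open>p * (1 - p)\<close>, attained at the
    midpoint of the segment.\<close>
  also have "\<dots> \<le> M * h\<^sup>2 / (2 * real N) * (1 / 4)"
  proof (rule mult_left_mono)
    have "0 \<le> (p - 1 / 2)\<^sup>2" by simp
    then show "p * (1 - p) \<le> 1 / 4" by (simp add: power2_eq_square algebra_simps)
  qed (use M0 in simp)
  finally show ?thesis by (simp add: h_def)
qed

lemma continuous_on_bern_segment: "continuous_on A (bern_segment x t N k)"
  unfolding bern_segment_def bern_basis_def divide_inverse by (intro continuous_intros)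

lemma knots_mono:
  fixes t :: "nat \<Rightarrow> 'a::order"
  assumes "\<And>k. k \<in> {1..K} \<Longrightarrow> t (k - 1) < t k" "i \<le> j" "j \<le> K"
  shows "t i \<le> t j"
  using \<open>i \<le> j\<close> \<open>j \<le> K\<close>
proof (induction j rule: dec_induct)
  case (step n)
  then show ?case using assms(1)[of "Suc n"] by fastforce
qed simp

text \<open>Serves twice: it turns the supremum in \<open>C\<close> into one over the whole
  interval, and it places every point of that interval in a segment.\<close>

lemma knots_cover:
  fixes t :: "nat \<Rightarrow> 'a::linorder"
  assumes "\<And>k. k \<in> {1..K} \<Longrightarrow> t (k - 1) < t k" "K \<ge> 1"
  shows "(\<Union>k\<in>{1..K}. {t (k - 1)..t k}) = {t 0..t K}"
  using assms(2,1)
proof (induction K rule: dec_induct)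
  case (step n)
  have "(\<Union>k\<in>{1..Suc n}. {t (k - 1)..t k}) = {t 0..t n} \<union> {t n..t (Suc n)}"
    using step by (simp add: atLeastAtMostSuc_conv Un_commute)
  also have "\<dots> = {t 0..t (Suc n)}"
    using knots_mono[of "Suc n" t 0 n] knots_mono[of "Suc n" t n "Suc n"] step.prems
    by (intro ivl_disj_un_two_touch) auto
  finally show ?case .
qed simp

text \<open>On each segment the approximant agrees with a polynomial, and the pieces are glued at
  the knots. The induction runs over \<open>m\<close> with \<open>K\<close> fixed, because the
  approximant itself depends on \<open>K\<close>.\<close>

lemma composite_bernstein_integrable:
  assumes N: "N \<ge> 1" and inc: "\<And>k. k \<in> {1..K} \<Longrightarrow> t (k - 1) < t k" and "m \<le> K"
  shows "composite_bernstein x t K N integrable_on {t 0..t m}"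
  using \<open>m \<le> K\<close>
proof (induction m)
  case (Suc m)
  have "bern_segment x t N (Suc m) integrable_on {t m..t (Suc m)}"
    by (rule integrable_continuous_real) (rule continuous_on_bern_segment)
  moreover have "composite_bernstein x t K N s = bern_segment x t N (Suc m) s"
    if "s \<in> {t m..t (Suc m)}" for s
    using that Suc.prems by (intro composite_bernstein_eq[OF N]) (erule inc, auto)
  ultimately have "composite_bernstein x t K N integrable_on {t m..t (Suc m)}"
    using integrable_cong by blast
  moreover have "t 0 \<le> t m" "t m \<le> t (Suc m)"
    using Suc.prems by (auto intro!: knots_mono[of K t, OF inc])
  ultimately show ?case
    using Suc Henstock_Kurzweil_Integration.integrable_combine by (metis Suc_leD)
qed (use integrable_on_refl[of _ "t 0"] in simp)

theorem lemma3:
  fixes x :: "real \<Rightarrow> real" and t :: "nat \<Rightarrow> real" and t\<^sub>f C\<^sub>t C :: real and K N :: nat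
  assumes "K \<ge> 1" and "N \<ge> 1"
    and "C2_on {0..t\<^sub>f} x"
    and "t 0 = 0" and "t K = t\<^sub>f"
    and "\<And>k. k \<in> {1..K} \<Longrightarrow> t (k - 1) < t k"
    and "C\<^sub>t > 0"
    and "\<And>k. k \<in> {1..K} \<Longrightarrow> \<bar>t k - t (k - 1)\<bar> \<le> C\<^sub>t / real K"
    and "C = C\<^sub>t ^ 3 / 8 *
           (SUP \<tau>\<in>(\<Union>k\<in>{1..K}. {t (k - 1)..t k}). \<bar>deriv_on {0..t\<^sub>f} (deriv_on {0..t\<^sub>f} x) \<tau>\<bar>)"
  shows "norm (integral {0..t\<^sub>f} (composite_bernstein x t K N) - integral {0..t\<^sub>f} x)
           \<le> C / (real K ^ 2 * real N)"
proof -
  let ?S = "{0..t\<^sub>f}"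
  let ?x'' = "deriv_on ?S (deriv_on ?S x)"
  note inc = assms(6)
  have cover: "(\<Union>k\<in>{1..K}. {t (k - 1)..t k}) = ?S"
    using knots_cover[of K t, OF inc] assms(1,4,5) by simp
  define M where "M = (SUP \<tau>\<in>?S. \<bar>?x'' \<tau>\<bar>)"
  \<comment> \<open>The segment error bound with the segment length replaced by its upper bound
    \<open>C\<^sub>t / K\<close>.\<close>
  define E where "E = M * (C\<^sub>t / real K)\<^sup>2 / (8 * real N)"
  have C: "C = C\<^sub>t ^ 3 / 8 * M" using assms(9) unfolding cover M_def .
  have "t\<^sub>f \<ge> 0" using knots_mono[of K t 0 K, OF inc] assms(4,5) by simp
  \<comment> \<open>A real supremum dominates its set only if the set is bounded above; continuity
    of the second derivative on a compact interval supplies this.\<close>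
  have "continuous_on ?S (\<lambda>\<tau>. \<bar>?x'' \<tau>\<bar>)"
    using assms(3) unfolding C2_on_def by (intro continuous_intros) auto
  then have "bdd_above ((\<lambda>\<tau>. \<bar>?x'' \<tau>\<bar>) ` ?S)"
    by (intro bounded_imp_bdd_above compact_imp_bounded compact_continuous_image) auto
  then have M: "\<bar>?x'' v\<bar> \<le> M" if "v \<in> ?S" for v
    unfolding M_def using that by (intro cSUP_upper)
  have "M \<ge> 0" using M[of 0] \<open>t\<^sub>f \<ge> 0\<close> by force
  have deriv: "(x has_vector_derivative deriv_on ?S x v) (at v within ?S)"
    "(deriv_on ?S x has_vector_derivative ?x'' v) (at v within ?S)" if "v \<in> ?S" for v
    using assms(3) that unfolding C2_on_def differentiable_on_def deriv_on_def
    by (auto simp flip: vector_derivative_works)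
  \<comment> \<open>\<open>integral\<close> takes a default value on non-integrable functions, so
    both integrals must exist before their difference is merged into one.\<close>
  have x_int: "x integrable_on ?S"
    using deriv(1) by (intro integrable_continuous_real) (rule continuous_on_vector_derivative)
  have xM_int: "composite_bernstein x t K N integrable_on ?S"
    using composite_bernstein_integrable[of N K t K x, OF _ inc] assms(2,4,5) by simp
  have err: "\<bar>composite_bernstein x t K N s - x s\<bar> \<le> E" if "s \<in> ?S" for s
  proof -
    have "s \<in> (\<Union>k\<in>{1..K}. {t (k - 1)..t k})" using that unfolding cover .
    then obtain k where k: "k \<in> {1..K}" "s \<in> {t (k - 1)..t k}" by blast
    have "{t (k - 1)..t k} \<subseteq> ?S" unfolding cover[symmetric] using k(1) by (rule UN_upper)
    then have "\<bar>bern_segment x t N k s - x s\<bar> \<le> M * (t k - t (k - 1))\<^sup>2 / (8 * real N)"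
      by (rule bern_segment_error[OF assms(2) inc[OF k(1)] _ deriv M k(2)])
    also have "\<dots> \<le> E"
      unfolding E_def using assms(8)[OF k(1)] inc[OF k(1)] \<open>M \<ge> 0\<close>
      by (intro divide_right_mono mult_left_mono power_mono) auto
    finally show ?thesis
      using composite_bernstein_eq[of N K t k s x, OF assms(2) inc k] by simp
  qed
  \<comment> \<open>Summing \<open>K\<close> segment lengths of at most \<open>C\<^sub>t / K\<close>
    gives \<open>t\<^sub>f \<le> C\<^sub>t\<close>. This is the third factor of
    \<open>C\<^sub>t ^ 3\<close>; the other two come from \<open>E\<close>.\<close>
  have "t m \<le> real m * (C\<^sub>t / real K)" if "m \<le> K" for m
    using that
  proof (induction m)
    case (Suc m)
    then show ?case using assms(8)[of "Suc m"] by (auto simp: algebra_simps add_divide_distrib)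
  qed (simp add: assms(4))
  from this[of K] have "t\<^sub>f \<le> C\<^sub>t" using assms(1,5) by simp
  have "norm (integral ?S (composite_bernstein x t K N) - integral ?S x)
      = norm (integral ?S (\<lambda>s. composite_bernstein x t K N s - x s))"
    using x_int xM_int by (simp add: integral_diff)
  also have "\<dots> \<le> integral ?S (\<lambda>s. E)"
    using err x_int xM_int
    by (intro integral_norm_bound_integral integrable_diff) (auto simp: integrable_const_ivl)
  also have "\<dots> = t\<^sub>f * E" using \<open>t\<^sub>f \<ge> 0\<close> by simp
  also have "\<dots> \<le> C\<^sub>t * E"
    using \<open>t\<^sub>f \<le> C\<^sub>t\<close> \<open>M \<ge> 0\<close> by (intro mult_right_mono) (auto simp: E_def)
  also have "\<dots> = C / (real K ^ 2 * real N)"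
    by (simp add: C E_def power_divide power2_eq_square power3_eq_cube mult_ac)
  finally show ?thesis .
qed

end
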